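(* Let $a<b$ be real numbers, let $f:[a,b]\to(0,\infty)$, and let $F:[a,b]\to(0,\infty)$ be an indefinite star-integral of $f$ on $[a,b]$. Then $F^{*}(x)=f(x)$ for every $x\in[a,b]$ (with the one-sided limit at the endpoints). Further, if $f$ is Riemann star-integrable on $[a,b]$, then its star-integral $M_a^b(f)$ satisfies $$M_a^b(f)=\frac{F(b)}{F(a)}.$$
   Context: Star-integral: a partition $P$ of $[a,b]$ is a choice of points $a=x_0<x_1<\dots<x_n=b$, with $\Delta x_i=x_i-x_{i-1}$ and $\mathrm{mesh}(P)=\max_i\Delta x_i$. A test set $T$ for $P$ is a choice of points $t_i$ with $x_{i-1}<t_i<x_i$ for $i=1,\dots,n$. Put $\mathcal{P}(f,P,T)=\prod_{i=1}^n f(t_i)^{\Delta x_i}$. The function $f$ is Riemann star-integrable on $[a,b]$ with star-integral $M\in\mathbb{R}$, written $M=M_a^b(f)$, if for every $\epsilon>0$ there is $\delta>0$ such that for every partition $P$ and every test set $T$ for $P$, $\mathrm{mesh}(P)<\delta$ implies $|\mathcal{P}(f,P,T)-M|<\epsilon$. Indefinite star-integral: for positive $f$ on an interval, an indefinite star-integral of $f$ is any function of the form $F(x)=\exp(H(x))$, where $H$ is an antiderivative of $\log f$ on the interval, i.e. $H$ is differentiable (one-sidedly at endpoints) with $H'(x)=\log(f(x))$ for all $x$ in the interval. In other words, $F(x)=\exp\left(\int\log(f(x))\,dx\right)$. Star-derivative: for a positive function $F$, $F^{*}(x)=\lim_{h\to0}\left(\frac{F(x+h)}{F(x)}\right)^{1/h}$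 whenever this limit exists; the assertion $F^*(x)=f(x)$ means that the limit exists and equals $f(x)$. *)

theory Defs
  imports "HOL-Analysis.Analysis"
begin

text \<open>
  Partitions and test sets are encoded as sequences indexed by \<^typ>\<open>nat\<close>; only the points
  \<open>x 0, ..., x n\<close> and the tags \<open>t 1, ..., t n\<close> matter.
\<close>

definition is_partition :: "real \<Rightarrow> real \<Rightarrow> nat \<Rightarrow> (nat \<Rightarrow> real) \<Rightarrow> bool" where
  "is_partition a b n x \<longleftrightarrow>
     1 \<le> n \<and> x 0 = a \<and> x n = b \<and> (\<forall>i\<in>{1..n}. x (i - 1) < x i)"

definition is_test_set :: "nat \<Rightarrow> (nat \<Rightarrow> real) \<Rightarrow> (nat \<Rightarrow> real) \<Rightarrow> bool" where
  "is_test_set n x t \<longleftrightarrow> (\<forall>i\<in>{1..n}. x (i - 1) < t i \<and> t i < x i)"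

definition mesh :: "nat \<Rightarrow> (nat \<Rightarrow> real) \<Rightarrow> real" where
  "mesh n x = Max ((\<lambda>i. x i - x (i - 1)) ` {1..n})"

definition star_product :: "(real \<Rightarrow> real) \<Rightarrow> nat \<Rightarrow> (nat \<Rightarrow> real) \<Rightarrow> (nat \<Rightarrow> real) \<Rightarrow> real" where
  "star_product f n x t = (\<Prod>i=1..n. f (t i) powr (x i - x (i - 1)))"

definition has_star_integral :: "(real \<Rightarrow> real) \<Rightarrow> real \<Rightarrow> real \<Rightarrow> real \<Rightarrow> bool" where
  "has_star_integral f M a b \<longleftrightarrow>
     (\<forall>\<epsilon>>0. \<exists>\<delta>>0. \<forall>n x t. is_partition a b n x \<longrightarrow> is_test_set n x t \<longrightarrow> mesh n x < \<delta>
        \<longrightarrow> \<bar>star_product f n x t - M\<bar> < \<epsilon>)"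

definition star_integrable :: "(real \<Rightarrow> real) \<Rightarrow> real \<Rightarrow> real \<Rightarrow> bool" where
  "star_integrable f a b \<longleftrightarrow> (\<exists>M. has_star_integral f M a b)"

definition star_integral :: "(real \<Rightarrow> real) \<Rightarrow> real \<Rightarrow> real \<Rightarrow> real" where
  "star_integral f a b = (THE M. has_star_integral f M a b)"

text \<open>
  Differentiation within \<open>S\<close> gives the one-sided derivative at an endpoint of an interval \<open>S\<close>;
  likewise, restricting \<open>h\<close> to \<open>x + h \<in> S\<close> below gives the one-sided limit.
\<close>

definition indefinite_star_integral ::
    "(real \<Rightarrow> real) \<Rightarrow> (real \<Rightarrow> real) \<Rightarrow> real set \<Rightarrow> bool" where
  "indefinite_star_integral F f S \<longleftrightarrow>
     (\<exists>H. (\<forall>x\<in>S. (H has_real_derivative ln (f x)) (at x within S)) \<and> (\<forall>x\<in>S. F x = exp (H x)))"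

definition has_star_derivative ::
    "(real \<Rightarrow> real) \<Rightarrow> real \<Rightarrow> real \<Rightarrow> real set \<Rightarrow> bool" where
  "has_star_derivative F D x S \<longleftrightarrow>
     ((\<lambda>h. (F (x + h) / F x) powr (1 / h)) \<longlongrightarrow> D) (at 0 within {h. x + h \<in> S})"

text \<open>The star-integral is unique, so that \<^const>\<open>star_integral\<close> is well defined.\<close>

lemma fine_partition_exists:
  assumes "a < b" "\<delta> > 0"
  obtains n x t where "is_partition a b n x" "is_test_set n x t" "mesh n x < \<delta>"
proof -
  obtain n :: nat where n: "(b - a) / \<delta> < real n"
    using reals_Archimedean2 by blast
  have "(b - a) / \<delta> > 0" using assms by simp
  then have n1: "1 \<le> n" using n by (cases n) auto
  define w where "w = (b - a) / real n"
  define x where "x = (\<lambda>i::nat. a + real i * w)"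
  have w0: "w > 0" using assms n1 by (simp add: w_def)
  have wd: "w < \<delta>" using n assms n1 by (simp add: w_def field_simps)
  have step: "x i - x (i - 1) = w" if "i \<in> {1..n}" for i
    using that by (simp add: x_def of_nat_diff algebra_simps)
  have xn: "x n = b" using n1 by (simp add: x_def w_def)
  have "is_partition a b n x"
    unfolding is_partition_def
  proof (intro conjI ballI)
    fix i assume "i \<in> {1..n}"
    then show "x (i - 1) < x i" using step[of i] w0 by linarith
  qed (use n1 xn in \<open>simp_all add: x_def\<close>)
  moreover have "is_test_set n x (\<lambda>i. x i - w / 2)"
    unfolding is_test_set_def
  proof
    fix i assume "i \<in> {1..n}"
    then show "x (i - 1) < x i - w / 2 \<and> x i - w / 2 < x i"
      using step[of i] w0 by linarith
  qed
  moreover have "(\<lambda>i. x i - x (i - 1)) ` {1..n} = {w}"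
    using step n1 by (auto simp: image_iff intro!: bexI[of _ 1])
  then have "mesh n x < \<delta>" using wd by (simp add: mesh_def)
  ultimately show ?thesis using that by blast
qed

lemma has_star_integral_unique:
  assumes "a < b" "has_star_integral f M a b" "has_star_integral f N a b"
  shows "M = N"
proof (rule ccontr)
  assume "M \<noteq> N"
  then have e: "\<bar>M - N\<bar> / 2 > 0" by simp
  obtain d1 where d1: "d1 > 0" "\<And>n x t. is_partition a b n x \<Longrightarrow> is_test_set n x t \<Longrightarrow>
      mesh n x < d1 \<Longrightarrow> \<bar>star_product f n x t - M\<bar> < \<bar>M - N\<bar> / 2"
    using assms(2) e unfolding has_star_integral_def by meson
  obtain d2 where d2: "d2 > 0" "\<And>n x t. is_partition a b n x \<Longrightarrow> is_test_set n x t \<Longrightarrow>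
      mesh n x < d2 \<Longrightarrow> \<bar>star_product f n x t - N\<bar> < \<bar>M - N\<bar> / 2"
    using assms(3) e unfolding has_star_integral_def by meson
  obtain n x t where p: "is_partition a b n x" "is_test_set n x t" "mesh n x < min d1 d2"
    using fine_partition_exists[OF assms(1), of "min d1 d2"] d1(1) d2(1) by auto
  show False using d1(2)[OF p(1,2)] d2(2)[OF p(1,2)] p(3) by (auto simp: abs_if split: if_splits)
qed

lemma star_integral_eqI:
  assumes "a < b" "has_star_integral f M a b"
  shows "star_integral f a b = M"
  unfolding star_integral_def using has_star_integral_unique[OF assms(1)] assms(2) by blast

end

theory Submission
  imports Defs
begin

text \<open>
  Write \<open>F = exp \<circ> H\<close> with \<open>H' = ln f\<close>. The star difference quotient of \<open>F\<close> is the exponential of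
  the ordinary difference quotient of \<open>H\<close>. For the star-integral, the mean value theorem applied to
  \<open>H\<close> on each piece of a partition gives tags for which the star product is exactly \<open>F b / F a\<close>;
  as such tags exist for arbitrarily fine partitions, no other limit is possible.
\<close>

text \<open>With \<open>S\<close> arbitrary, the same argument covers interior points and the
  one-sided limits at endpoints.\<close>

lemma exp_has_star_derivative:
  assumes "(H has_real_derivative D) (at x within S)"
    and "\<And>y. y \<in> S \<Longrightarrow> F y = exp (H y)" and "x \<in> S"
  shows "has_star_derivative F (exp D) x S"
proof -
  \<comment> \<open>The substitution \<open>y = x + h\<close>. The radius 1 is arbitrary, since
    \<open>x + h\<close> differs from \<open>x\<close> for every nonzero \<open>h\<close>.\<close>
  have shift: "filterlim (\<lambda>h. x + h) (at x within S) (at 0 within {h. x + h \<in> S})"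
    unfolding filterlim_at
    by (auto simp: eventually_at intro!: exI[of _ 1] tendsto_eq_intros)
  have "((\<lambda>y. (H y - H x) / (y - x)) \<longlongrightarrow> D) (at x within S)"
    using assms(1) by (simp add: has_field_derivative_iff)
  from tendsto_exp[OF filterlim_compose[OF this shift]]
  have "((\<lambda>h. exp ((H (x + h) - H x) / h)) \<longlongrightarrow> exp D) (at 0 within {h. x + h \<in> S})"
    by simp
  \<comment> \<open>The identity holds at every nonzero \<open>h\<close> with \<open>x + h\<close>
    in \<open>S\<close>: the quotient is the exponential of an increment of \<open>H\<close>, so the
    base of \<open>powr\<close> is not 0.\<close>
  moreover have "\<forall>\<^sub>F h in at 0 within {h. x + h \<in> S}.
      exp ((H (x + h) - H x) / h) = (F (x + h) / F x) powr (1 / h)"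
    unfolding eventually_at_filter
    using assms(2,3) by (intro always_eventually) (auto simp: powr_def exp_diff[symmetric])
  ultimately show ?thesis
    unfolding has_star_derivative_def by (rule Lim_transform_eventually)
qed

lemma is_partition_mono:
  assumes "is_partition a b n x" "i \<le> j" "j \<le> n"
  shows "x i \<le> x j"
  using assms(2,3)
proof (induction j rule: dec_induct)
  case (step j)
  moreover have "x (Suc j - 1) < x (Suc j)"
    using assms(1) step.prems unfolding is_partition_def
    by (metis atLeastAtMost_iff le_add1 plus_1_eq_Suc)
  ultimately show ?case by simp
qed simp

text \<open>The mean value theorem makes each factor the exponential of an increment of
  \<open>H\<close>, and the increments telescope.\<close>

lemma mean_value_test_set:
  assumes "is_partition a b n x"
    and deriv: "\<And>y. y \<in> {a..b} \<Longrightarrow> (H has_real_derivative ln (f y)) (at y within {a..b})"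
    and pos: "\<And>y. y \<in> {a..b} \<Longrightarrow> 0 < f y"
  obtains t where "is_test_set n x t" "star_product f n x t = exp (H b - H a)"
proof -
  have ends: "x 0 = a" "x n = b" using assms(1) by (auto simp: is_partition_def)
  have piece: "{x (i - 1)..x i} \<subseteq> {a..b}" if "i \<in> {1..n}" for i
    using is_partition_mono[OF assms(1), of 0 "i - 1"] is_partition_mono[OF assms(1), of i n] that ends
    by auto
  have "\<exists>s. x (i - 1) < s \<and> s < x i \<and> H (x i) - H (x (i - 1)) = ln (f s) * (x i - x (i - 1))"
    if i: "i \<in> {1..n}" for i
  proof -
    have "x (i - 1) < x i" using assms(1) i by (auto simp: is_partition_def)
    moreover have "(H has_derivative (*) (ln (f y))) (at y within {x (i - 1)..x i})"
      if "y \<in> {x (i - 1)..x i}" for y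
      using deriv[of y] piece[OF i] that
      by (meson has_field_derivative_def has_field_derivative_subset subsetD)
    \<comment> \<open>The mean value point is interior to the piece, as the strict inequalities of a
      test set require.\<close>
    ultimately show ?thesis
      using mvt_simple[of "x (i - 1)" "x i" H "\<lambda>y. (*) (ln (f y))"] by (auto simp: Bex_def)
  qed
  then obtain t where t: "\<And>i. i \<in> {1..n} \<Longrightarrow> x (i - 1) < t i \<and> t i < x i \<and>
      H (x i) - H (x (i - 1)) = ln (f (t i)) * (x i - x (i - 1))"
    by metis
  have "f (t i) powr (x i - x (i - 1)) = exp (H (x i) - H (x (i - 1)))" if i: "i \<in> {1..n}" for i
  proof -
    have "t i \<in> {a..b}" using t[OF i] piece[OF i] by auto
    from pos[OF this] show ?thesis using t[OF i] by (simp add: powr_def mult.commute)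
  qed
  then have "star_product f n x t = exp (\<Sum>i=1..n. H (x i) - H (x (i - 1)))"
    unfolding star_product_def exp_sum[OF finite_atLeastAtMost] by (rule prod.cong[OF refl])
  also have "(\<Sum>i=1..n. H (x i) - H (x (i - 1))) = H b - H a"
    using sum_telescope''[of 0 n "\<lambda>i. H (x i)"] by (simp add: ends)
  finally have "star_product f n x t = exp (H b - H a)" .
  moreover have "is_test_set n x t" using t by (simp add: is_test_set_def)
  ultimately show ?thesis using that by blast
qed

lemma has_star_integral_eq_exp_diff:
  assumes "a < b" "has_star_integral f M a b"
    and "\<And>y. y \<in> {a..b} \<Longrightarrow> (H has_real_derivative ln (f y)) (at y within {a..b})"
    and "\<And>y. y \<in> {a..b} \<Longrightarrow> 0 < f y"
  shows "M = exp (H b - H a)"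
proof -
  have "\<bar>exp (H b - H a) - M\<bar> < \<epsilon>" if "\<epsilon> > 0" for \<epsilon>
  proof -
    obtain \<delta> where \<delta>: "\<delta> > 0" "\<And>n x t. is_partition a b n x \<Longrightarrow> is_test_set n x t \<Longrightarrow>
        mesh n x < \<delta> \<Longrightarrow> \<bar>star_product f n x t - M\<bar> < \<epsilon>"
      using assms(2) \<open>\<epsilon> > 0\<close> unfolding has_star_integral_def by metis
    \<comment> \<open>Only the fine partition is kept; its tags give way to mean value tags.\<close>
    obtain n x where p: "is_partition a b n x" "mesh n x < \<delta>"
      using fine_partition_exists[OF assms(1) \<delta>(1)] by blast
    obtain t where "is_test_set n x t" "star_product f n x t = exp (H b - H a)"
      using mean_value_test_set[OF p(1) assms(3,4)] by blast
    with \<delta>(2)[OF p(1) _ p(2)] show ?thesis by metis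
  qed
  \<comment> \<open>With the distance itself as \<open>\<epsilon>\<close>, a nonzero distance would
    be smaller than itself.\<close>
  from this[of "\<bar>exp (H b - H a) - M\<bar>"] show ?thesis by force
qed

theorem theorem6p1:
  fixes a b :: real and f F :: "real \<Rightarrow> real"
  assumes "a < b"
    and "\<And>x. x \<in> {a..b} \<Longrightarrow> 0 < f x"
    and "\<And>x. x \<in> {a..b} \<Longrightarrow> 0 < F x"
    and "indefinite_star_integral F f {a..b}"
  shows "(\<forall>x\<in>{a..b}. has_star_derivative F (f x) x {a..b}) \<and>
         (star_integrable f a b \<longrightarrow> star_integral f a b = F b / F a)"
proof -
  obtain H where H: "\<And>x. x \<in> {a..b} \<Longrightarrow> (H has_real_derivative ln (f x)) (at x within {a..b})"
    and F: "\<And>x. x \<in> {a..b} \<Longrightarrow> F x = exp (H x)"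
    using assms(4) unfolding indefinite_star_integral_def by blast
  have "has_star_derivative F (f x) x {a..b}" if "x \<in> {a..b}" for x
    using exp_has_star_derivative[OF H[OF that] F that] assms(2)[OF that] by simp
  \<comment> \<open>Uniqueness identifies the definite description
    \<open>star_integral f a b\<close> with any witness \<open>M\<close>.\<close>
  moreover have "star_integral f a b = F b / F a" if "has_star_integral f M a b" for M
    using star_integral_eqI[OF assms(1) that]
      has_star_integral_eq_exp_diff[OF assms(1) that H assms(2)] F assms(1)
    by (simp add: exp_diff)
  ultimately show ?thesis unfolding star_integrable_def by blast
qed

end
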